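(* Let $r\ge 3$ be odd. Every complete bipartite graph $K_{s,t}$ of order $s+t\ge r$ is $r$-void.
   Context: For a graph $G$ of order $n$ and an integer $r$ with $2<r\le n$: $G$ is called $r$-complete if every subgraph of $G$ induced by $r$ vertices has an odd number of edges; $r$-void if every subgraph induced by $r$ vertices has an even number of edges; and $r$-neutral if it is neither $r$-complete nor $r$-void. *)

theory Defs
  imports "Graph_Theory.Graph_Theory"
begin

text \<open>
  Finite simple graphs are rendered as \<^const>\<open>graph\<close>: each undirected edge consists of two
  opposite arcs, so edges are counted as unordered pairs of end vertices rather than as arcs.
\<close>

definition undirected_edges :: "('a, 'b) pre_digraph \<Rightarrow> 'a set set" where
  "undirected_edges G = (\<lambda>e. {tail G e, head G e}) ` arcs G"

definition r_void :: "nat \<Rightarrow> ('a, 'b) pre_digraph \<Rightarrow> bool" where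
  "r_void r G \<longleftrightarrow> graph G \<and> 2 < r \<and> r \<le> card (verts G) \<and>
     (\<forall>H. induced_subgraph H G \<and> card (verts H) = r \<longrightarrow> even (card (undirected_edges H)))"

end

theory Submission
  imports Defs
begin

text \<open>
  An induced subgraph of a complete bipartite graph is again complete bipartite. If its parts have
  sizes \<open>a\<close> and \<open>b\<close>, it has \<open>a * b\<close> edges, and one factor is even because \<open>a + b\<close> is odd.
\<close>

text \<open>Arcs matter for edge counting only through their end pairs, and
  \<open>complete_bipartite_digraph\<close> constrains arcs only through
  \<open>arcs_ends\<close>.\<close>

lemma undirected_edges_conv_arcs_ends:
  "undirected_edges G = (\<lambda>(u, v). {u, v}) ` arcs_ends G"
  by (simp add: undirected_edges_def arcs_ends_conv image_image)

lemma arcs_ends_induced_subgraph: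
  assumes "induced_subgraph H G"
  shows "arcs_ends H = arcs_ends G \<inter> verts H \<times> verts H"
proof -
  have "tail H = tail G" "head H = head G"
    and "arcs H = {e \<in> arcs G. tail G e \<in> verts H \<and> head G e \<in> verts H}"
    using assms by (auto simp: induced_subgraph_def subgraph_def compatible_def)
  then show ?thesis by (auto simp: arcs_ends_conv)
qed

text \<open>The parts of \<open>H\<close> are the traces on \<open>verts H\<close> of the two parts
  of \<open>G\<close>. Either trace may be empty, so \<open>a\<close> or \<open>b\<close> can be
  0.\<close>

lemma complete_bipartite_digraph_induced_subgraph:
  assumes "complete_bipartite_digraph s t G" and "induced_subgraph H G"
  obtains a b where "complete_bipartite_digraph a b H"
proof -
  from assms(1) obtain U V where G: "graph G" "verts G = U \<union> V" "U \<inter> V = {}"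
      "arcs_ends G = U \<times> V \<union> V \<times> U"
    unfolding complete_bipartite_digraph_def by blast
  let ?U = "U \<inter> verts H" and ?V = "V \<inter> verts H"
  from G(1) interpret G: graph G .
  have "verts H \<subseteq> verts G"
    using assms(2) by (auto simp: induced_subgraph_def subgraph_def)
  then have "verts H = ?U \<union> ?V" "?U \<inter> ?V = {}"
    using G by auto
  moreover have arcs: "arcs_ends H = ?U \<times> ?V \<union> ?V \<times> ?U"
    unfolding arcs_ends_induced_subgraph[OF assms(2)] G(4) by blast
  moreover have "graph H"
  proof -
    \<comment> \<open>Being a \<open>graph\<close> amounts to being a \<open>digraph\<close> with
      symmetric arcs. The first passes to induced subgraphs; the second is read off the shape of
      \<open>arcs_ends H\<close>.\<close>
    have "digraph H"
      using assms(2) by (rule G.digraphI_induced)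
    moreover have "symmetric H"
      unfolding symmetric_def arcs by (auto intro: symI)
    ultimately show ?thesis
      by (simp add: graph_def pseudo_graph_def digraph_def fin_digraph_def
          sym_digraph_def sym_digraph_axioms_def)
  qed
  ultimately have "complete_bipartite_digraph (card ?U) (card ?V) H"
    unfolding complete_bipartite_digraph_def by blast
  then show thesis by (rule that)
qed

lemma card_verts_complete_bipartite_digraph:
  assumes "complete_bipartite_digraph s t G"
  shows "card (verts G) = s + t"
proof -
  from assms obtain U V where G: "graph G" "verts G = U \<union> V" "U \<inter> V = {}" "card U = s" "card V = t"
    unfolding complete_bipartite_digraph_def by blast
  from G(1) interpret G: graph G .
  \<comment> \<open>Cardinalities of disjoint sets add only for finite sets; finiteness comes from
    \<open>G\<close> being a finite graph.\<close>
  have "finite U" "finite V"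
    using G.finite_verts by (simp_all add: G(2))
  then show ?thesis
    using G by (simp add: card_Un_disjoint)
qed

lemma card_undirected_edges_complete_bipartite_digraph:
  assumes "complete_bipartite_digraph s t G"
  shows "card (undirected_edges G) = s * t"
proof -
  from assms obtain U V where G: "U \<inter> V = {}" "card U = s" "card V = t"
      "arcs_ends G = U \<times> V \<union> V \<times> U"
    unfolding complete_bipartite_digraph_def by blast
  \<comment> \<open>Opposite arcs give the same doubleton, so one orientation suffices.\<close>
  have "undirected_edges G = (\<lambda>(u, v). {u, v}) ` (U \<times> V)"
    unfolding undirected_edges_conv_arcs_ends G(4) by (auto simp: image_iff insert_commute)
  \<comment> \<open>A crosswise match of two doubletons would put a vertex into both
    \<open>U\<close> and \<open>V\<close>.\<close>
  moreover have "inj_on (\<lambda>(u, v). {u, v}) (U \<times> V)"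
    using G(1) by (auto simp: inj_on_def doubleton_eq_iff)
  ultimately show ?thesis
    using G by (simp add: card_image card_cartesian_product)
qed

theorem theorem8:
  fixes G :: "('a, 'b) pre_digraph" and r s t :: nat
  assumes "r \<ge> 3" and "odd r"
    and "complete_bipartite_digraph s t G"
    and "s + t \<ge> r"
  shows "r_void r G"
proof -
  have "even (card (undirected_edges H))"
    if H: "induced_subgraph H G" "card (verts H) = r" for H
  proof -
    obtain a b where K: "complete_bipartite_digraph a b H"
      using complete_bipartite_digraph_induced_subgraph[OF assms(3) H(1)] .
    \<comment> \<open>This sum is the order \<open>r\<close> of \<open>H\<close>; how
      \<open>r\<close> splits between the parts is irrelevant.\<close>
    have "odd (a + b)"
      using card_verts_complete_bipartite_digraph[OF K] H(2) assms(2) by simp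
    then show ?thesis
      by (auto simp: card_undirected_edges_complete_bipartite_digraph[OF K])
  qed
  moreover have "graph G"
    using assms(3) by (simp add: complete_bipartite_digraph_def)
  ultimately show ?thesis
    using assms by (auto simp: r_void_def card_verts_complete_bipartite_digraph[OF assms(3)])
qed

end
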